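(* Let $G>0$, $M>0$, $M_*\ge 0$, $L>0$, $U\in(0,L)$ and $v_0<0$ be real numbers, and set $a=2GM$, $b=2GM_*$. Let $u$ be the maximal solution for $t\ge 0$, with values in $(0,L)$, of $$u''=-\frac{a}{2u^2}-\frac{b}{2(L-u)^2},\qquad u(0)=U,\quad u'(0)=v_0 .$$ Then $u$ is decreasing and vanishes in finite time: there is a finite $T>0$ such that $u$ exists on $[0,T)$, $u(t)\in(0,L)$ for $t\in[0,T)$, $\lim_{t\to T^-}u(t)=0$, and $$T\le \frac{U}{|u'(0)|}.$$
   Context: The model: an attractor of mass $M$ is fixed at the origin of the real line, a repeller modeled by a negative mass $-M_*$ is fixed at the point $L>0$, and a light body moves on the segment $(0,L)$ at position $u(t)$, its initial velocity pointing towards the attractor. The time $T$ is called the collapsing time. *)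

theory Defs
  imports "HOL-Analysis.Analysis"
begin

text \<open>
  Solutions for \<open>t \<ge> 0\<close> of \<open>u'' = F(u)\<close>, \<open>u(0) = x0\<close>, \<open>u'(0) = v0\<close> with values in \<open>S\<close>.
  The domain \<open>I\<close> is any nondegenerate interval (open or closed on the right, possibly unbounded)
  with least element \<open>0\<close>; derivatives are taken within \<open>I\<close>, hence one-sided at its end points.
  The values of \<open>u\<close> outside \<open>I\<close> carry no information.
\<close>

definition solves_on ::
    "(real \<Rightarrow> real) \<Rightarrow> real set \<Rightarrow> real \<Rightarrow> real \<Rightarrow> real set \<Rightarrow> (real \<Rightarrow> real) \<Rightarrow> bool" where
  "solves_on F S x0 v0 I u \<longleftrightarrow>
     is_interval I \<and> 0 \<in> I \<and> I \<subseteq> {0..} \<and> I \<noteq> {0} \<and>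
     (\<forall>t\<in>I. u t \<in> S) \<and> u 0 = x0 \<and>
     (\<exists>v. v 0 = v0 \<and>
        (\<forall>t\<in>I. (u has_real_derivative v t) (at t within I) \<and>
                (v has_real_derivative F (u t)) (at t within I)))"

definition maximal_solution ::
    "(real \<Rightarrow> real) \<Rightarrow> real set \<Rightarrow> real \<Rightarrow> real \<Rightarrow> real set \<Rightarrow> (real \<Rightarrow> real) \<Rightarrow> bool" where
  "maximal_solution F S x0 v0 I u \<longleftrightarrow>
     solves_on F S x0 v0 I u \<and>
     (\<forall>J w. solves_on F S x0 v0 J w \<longrightarrow> I \<subseteq> J \<longrightarrow> (\<forall>t\<in>I. w t = u t) \<longrightarrow> J = I)"

end

theory Submission
  imports Defs
begin

text \<open>
  The proof rests on two properties of the force: it is continuous and never points away from the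
  attractor. Along a solution the velocity therefore stays at or below \<open>v0 < 0\<close>, and conservation of energy
  makes the squared speed a function \<open>Q\<close> of the position, where \<open>Q\<close> is an antiderivative of \<open>2 F\<close>
  with \<open>Q U = v0\<^sup>2\<close>. Hence the time needed to fall from \<open>U\<close> to \<open>x\<close> is a function \<open>\<tau>\<close> of the position
  as well: \<open>\<tau>' = - 1 / sqrt Q\<close> and \<open>\<tau> U = 0\<close>.

  Since the speed is at least \<open>\<bar>v0\<bar>\<close>, the function \<open>\<tau>\<close> is bounded by \<open>U / \<bar>v0\<bar>\<close> on \<open>(0, U]\<close>. It maps
  this interval decreasingly onto some \<open>[0, T)\<close>, and its inverse \<open>w\<close> is a solution on \<open>[0, T)\<close> that
  tends to \<open>0\<close> at \<open>T\<close> (\<open>fall_time_inverse\<close>). Conversely, \<open>\<tau> (u t) = t\<close> for every solution \<open>u\<close>,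
  because both sides have derivative \<open>1\<close> and agree at \<open>0\<close> (\<open>fall_time_along_solution\<close>). So every
  solution is a restriction of \<open>w\<close>, and the maximal one is \<open>w\<close> itself. This explicit description
  replaces the usual local existence, uniqueness and continuation theorems.
\<close>

section \<open>Antiderivatives and mean values on intervals\<close>

lemma antiderivative_on_open_interval:
  fixes f :: "real \<Rightarrow> real"
  assumes "p < q" and "continuous_on {p<..<q} f"
  obtains g where "g c = d" and "\<And>x. x \<in> {p<..<q} \<Longrightarrow> (g has_real_derivative f x) (at x)"
proof -
  have "isCont f x" if "ereal p < ereal x" "ereal x < ereal q" for x
    using assms that by (simp add: continuous_on_eq_continuous_at)
  then obtain g where g: "\<And>x. p < x \<Longrightarrow> x < q \<Longrightarrow> (g has_real_derivative f x) (at x)"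
    using einterval_antiderivative[of "ereal p" "ereal q" f] assms(1)
    by (auto simp: has_real_derivative_iff_has_vector_derivative)
  have "((\<lambda>x. g x - g c + d) has_real_derivative f x) (at x)" if "x \<in> {p<..<q}" for x
    using that by (auto intro!: derivative_eq_intros g)
  then show ?thesis
    using that[of "\<lambda>x. g x - g c + d"] by simp
qed

lemma mvt_within_interval:
  fixes f f' :: "real \<Rightarrow> real"
  assumes "is_interval I" and "s \<in> I" and "t \<in> I" and "s < t"
    and "\<And>r. r \<in> I \<Longrightarrow> (f has_real_derivative f' r) (at r within I)"
  obtains r where "r \<in> I" and "f t - f s = f' r * (t - s)"
proof -
  have sub: "{s..t} \<subseteq> I"
    using assms(1-3) by (meson atLeastAtMost_iff is_interval_1 subsetI)
  obtain r where "r \<in> {s<..<t}" "f t - f s = f' r * (t - s)"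
    using mvt_simple[OF assms(4), of f "\<lambda>r. (*) (f' r)"] sub assms(5)
    by (meson DERIV_subset atLeastAtMost_iff has_field_derivative_def subsetD)
  moreover from this have "r \<in> I" using sub by auto
  ultimately show ?thesis using that by blast
qed

section \<open>Inverting the fall time\<close>

text \<open>
  A one-dimensional motion may be described by the time \<open>\<tau>\<close> at which each position is reached; here
  \<open>h\<close> is the slowness, that is the reciprocal of the speed. Letting \<open>\<tau>\<close> live on a neighbourhood of the
  starting point \<open>U\<close>, rather than on \<open>(0, U]\<close>, makes time \<open>0\<close> an interior point of its range, so that
  the inverse \<open>w\<close> has two-sided derivatives everywhere.
\<close>

lemma fall_time_inverse:
  fixes \<tau> h :: "real \<Rightarrow> real"
  assumes "U \<in> {0<..<L}" and "\<tau> U = 0"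
    and der: "\<And>x. x \<in> {0<..<L} \<Longrightarrow> (\<tau> has_real_derivative - h x) (at x)"
    and h_pos: "\<And>x. x \<in> {0<..<L} \<Longrightarrow> 0 < h x"
    and h_le: "\<And>x. x \<in> {0<..<L} \<Longrightarrow> h x \<le> K"
  obtains w T where "0 < T" and "T \<le> K * U" and "w 0 = U"
    and "\<And>t. t \<in> {0..<T} \<Longrightarrow> w t \<in> {0<..U}"
    and "\<And>t. t \<in> {0..<T} \<Longrightarrow> (w has_real_derivative - 1 / h (w t)) (at t)"
    and "\<And>x. x \<in> {0<..<L} \<Longrightarrow> 0 \<le> \<tau> x \<Longrightarrow> \<tau> x < T \<and> w (\<tau> x) = x"
    and "(w \<longlongrightarrow> 0) (at_left T)"
proof -
  have U: "0 < U" "U < L" using assms(1) by auto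
  have dec: "\<tau> y < \<tau> x" if xy: "0 < x" "x < y" "y < L" for x y
  proof (rule DERIV_neg_imp_decreasing[OF xy(2)])
    fix z assume "x \<le> z" "z \<le> y"
    then have z: "z \<in> {0<..<L}" using xy by simp
    show "\<exists>d. (\<tau> has_real_derivative d) (at z) \<and> d < 0"
      using der[OF z] h_pos[OF z] by (intro exI[of _ "- h z"]) simp
  qed
  have dec_iff: "\<tau> y < \<tau> x \<longleftrightarrow> x < y" if "0 < x" "x < L" "0 < y" "y < L" for x y
    using dec[of x y] dec[of y x] that by (cases x y rule: linorder_cases) auto
  have cont: "isCont \<tau> x" if "0 < x" "x < L" for x
    using der that DERIV_isCont by auto
  define w where "w = inv_into {0<..<L} \<tau>"
  have "inj_on \<tau> {0<..<L}"
    by (rule inj_onI) (use dec in \<open>metis greaterThanLessThan_iff less_irrefl linorder_neqE\<close>)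
  then have w_tau: "w (\<tau> x) = x" if "0 < x" "x < L" for x
    using that by (simp add: w_def)
  have ivt: "\<exists>x. a \<le> x \<and> x \<le> b \<and> \<tau> x = t"
    if "0 < a" "a \<le> b" "b < L" "\<tau> b \<le> t" "t \<le> \<tau> a" for a b t
    using that by (intro IVT2) (auto intro!: cont)
  have K: "0 < K" using h_pos[OF assms(1)] h_le[OF assms(1)] by simp
  have bound: "\<tau> x \<le> K * U" if x: "0 < x" "x \<le> U" for x
  proof (cases "x = U")
    case False
    then have "x < U" using that by simp
    then obtain z where z: "x < z" "z < U" "\<tau> U - \<tau> x = (U - x) * - h z"
      using MVT2[of x U \<tau> "\<lambda>z. - h z"] der x U by auto
    have "h z \<le> K" using h_le z(1,2) that U by simp
    moreover have "0 < h z" using h_pos z(1,2) that U by simp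
    ultimately have "(U - x) * h z \<le> U * K"
      using that by (intro mult_mono) auto
    then show ?thesis using z(3) assms(2) by (simp add: mult.commute)
  qed (use K U assms(2) in simp)
  define T where "T = Sup (\<tau> ` {0<..U})"
  have bdd: "bdd_above (\<tau> ` {0<..U})"
    using bound by (intro bdd_aboveI2) auto
  have tau_less: "\<tau> x < T" if "0 < x" "x \<le> U" for x
  proof -
    have "\<tau> x < \<tau> (x / 2)" using dec that U by simp
    also have "\<dots> \<le> T" unfolding T_def by (rule cSUP_upper[OF _ bdd]) (use that in auto)
    finally show ?thesis .
  qed
  have reached: "\<exists>x. 0 < x \<and> x \<le> U \<and> \<tau> x = t" if t: "0 \<le> t" "t < T" for t
  proof -
    have "{0<..U} \<noteq> {}" using U by simp
    then obtain a where a: "0 < a" "a \<le> U" "t < \<tau> a"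
      using less_cSUP_iff[of "{0<..U}" \<tau> t] bdd t(2) unfolding T_def by auto
    then obtain x where "a \<le> x" "x \<le> U" "\<tau> x = t"
      using ivt[of a U t] U assms(2) t(1) by auto
    then show ?thesis using a by (intro exI[of _ x]) simp
  qed
  have w_props: "0 < w t \<and> w t \<le> U \<and> \<tau> (w t) = t" if "0 \<le> t" "t < T" for t
    using reached[OF that] w_tau U by fastforce
  show ?thesis
  proof
    show "0 < T" using tau_less[of U] U assms(2) by simp
    show "T \<le> K * U"
      unfolding T_def by (rule cSUP_least) (use bound U in auto)
    show "w 0 = U" using w_tau[of U] U assms(2) by simp
    show "w t \<in> {0<..U}" if "t \<in> {0..<T}" for t using w_props that by simp
    show "\<tau> x < T \<and> w (\<tau> x) = x" if "x \<in> {0<..<L}" "0 \<le> \<tau> x" for x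
    proof -
      have "x \<le> U" using dec_iff[of U x] that U assms(2) by force
      then show ?thesis using that tau_less w_tau by simp
    qed
    show "(w has_real_derivative - 1 / h (w t)) (at t)" if "t \<in> {0..<T}" for t
    proof -
      define x where "x = w t"
      have x: "0 < x" "x < L" "\<tau> x = t"
        using w_props[of t] that U by (auto simp: x_def)
      define a b where "a = x / 2" and "b = (x + L) / 2"
      have ab: "0 < a" "a < x" "x < b" "b < L" using x by (auto simp: a_def b_def)
      have "isCont w (\<tau> x)"
        by (rule isCont_inverse_function2[of a x b])
          (use ab w_tau cont in auto)
      then have "isCont w t" using x(3) by simp
      moreover have "\<tau> (w s) = s" if "\<tau> b < s" "s < \<tau> a" for s
        using ivt[of a b s] ab that w_tau by force
      moreover have "\<tau> b < t" "t < \<tau> a" using dec[of x b] dec[of a x] ab x by auto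
      moreover have "(\<tau> has_real_derivative - h x) (at (w t))" "- h x \<noteq> 0"
        using der[of x] h_pos[of x] x by (auto simp: x_def)
      ultimately have "(w has_real_derivative inverse (- h x)) (at t)"
        using DERIV_inverse_function[of \<tau> "- h x" w t "\<tau> b" "\<tau> a"] by blast
      then show ?thesis by (simp add: x_def field_simps)
    qed
    show "(w \<longlongrightarrow> 0) (at_left T)"
    proof (rule tendstoI)
      fix e :: real assume "0 < e"
      define d where "d = min e U"
      have d: "0 < d" "d \<le> U" "d \<le> e" using \<open>0 < e\<close> U by (auto simp: d_def)
      have "dist (w t) 0 < e" if "\<tau> d < t" "t < T" for t
      proof -
        have "0 \<le> \<tau> d" using dec[of d U] d U assms(2) by force
        then have "0 < w t" "w t \<le> U" "\<tau> (w t) = t" using w_props[of t] that by auto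
        then show ?thesis using dec_iff[of "w t" d] that d U by simp
      qed
      then show "\<forall>\<^sub>F t in at_left T. dist (w t) 0 < e"
        using tau_less[of d] d eventually_at_left_field by blast
    qed
  qed
qed

section \<open>Energy and fall time along a solution\<close>

text \<open>
  The velocity can only decrease, so it stays negative; its sign then allows it to be recovered
  from the conserved energy \<open>v\<^sup>2 - Q u\<close>.
\<close>

lemma velocity_from_energy:
  assumes sol: "solves_on F S U v0 I u" and "v0 < 0"
    and F_le: "\<And>x. x \<in> S \<Longrightarrow> F x \<le> 0"
    and Q: "\<And>x. x \<in> S \<Longrightarrow> (Q has_real_derivative 2 * F x) (at x)" "Q U = v0\<^sup>2"
  shows "\<And>t. t \<in> I \<Longrightarrow> v0\<^sup>2 \<le> Q (u t)"
    and "\<And>t. t \<in> I \<Longrightarrow> (u has_real_derivative - sqrt (Q (u t))) (at t within I)"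
proof -
  from sol obtain v where I: "is_interval I" "0 \<in> I" "I \<subseteq> {0..}"
    and uS: "\<And>t. t \<in> I \<Longrightarrow> u t \<in> S" and u0: "u 0 = U" and v0: "v 0 = v0"
    and du: "\<And>t. t \<in> I \<Longrightarrow> (u has_real_derivative v t) (at t within I)"
    and dv: "\<And>t. t \<in> I \<Longrightarrow> (v has_real_derivative F (u t)) (at t within I)"
    unfolding solves_on_def by blast
  have v_le: "v t \<le> v0" if t: "t \<in> I" for t
  proof (cases "t = 0")
    case False
    then have "0 < t" using I(3) t by force
    then obtain r where r: "r \<in> I" "v t - v 0 = F (u r) * (t - 0)"
      using mvt_within_interval[OF I(1,2) t, of v "\<lambda>r. F (u r)"] dv by blast
    have "F (u r) * (t - 0) \<le> 0"
      using F_le[OF uS[OF r(1)]] \<open>0 < t\<close> by (simp add: mult_nonpos_nonneg)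
    then show ?thesis using r(2) v0 by simp
  qed (simp add: v0)
  have "\<exists>c. \<forall>t\<in>I. (v t)\<^sup>2 - Q (u t) = c"
  proof (rule has_field_derivative_zero_constant)
    show "convex I" using I(1) by (simp add: is_interval_convex)
    fix t assume t: "t \<in> I"
    have "((\<lambda>t. Q (u t)) has_real_derivative 2 * F (u t) * v t) (at t within I)"
      using DERIV_chain2[OF Q(1)[OF uS[OF t]] du[OF t]] .
    then show "((\<lambda>t. (v t)\<^sup>2 - Q (u t)) has_real_derivative 0) (at t within I)"
      by (auto intro!: derivative_eq_intros dv[OF t])
  qed
  then have "(v t)\<^sup>2 - Q (u t) = (v 0)\<^sup>2 - Q (u 0)" if "t \<in> I" for t
    using that I(2) by metis
  then have energy: "Q (u t) = (v t)\<^sup>2" if "t \<in> I" for t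
    using that u0 v0 Q(2) by force
  fix t assume t: "t \<in> I"
  show "v0\<^sup>2 \<le> Q (u t)"
    using energy[OF t] v_le[OF t] \<open>v0 < 0\<close> power_mono[of "- v0" "- v t" 2] by simp
  have "- sqrt (Q (u t)) = v t"
    using energy[OF t] v_le[OF t] \<open>v0 < 0\<close> by simp
  then show "(u has_real_derivative - sqrt (Q (u t))) (at t within I)"
    using du[OF t] by simp
qed

text \<open>
  With \<open>1 / v t\<close> as derivative of \<open>\<tau>\<close> at the position \<open>u t\<close>, the velocity cancels in the chain rule:
  whatever solution is followed, the clock \<open>\<tau>\<close> shows the true time. This is the uniqueness
  statement.
\<close>

lemma fall_time_along_solution:
  assumes "is_interval I" and "0 \<in> I" and "\<tau> (u 0) = 0"
    and du: "\<And>t. t \<in> I \<Longrightarrow> (u has_real_derivative v t) (at t within I)"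
    and d\<tau>: "\<And>t. t \<in> I \<Longrightarrow> (\<tau> has_real_derivative 1 / v t) (at (u t))"
    and "\<And>t. t \<in> I \<Longrightarrow> v t \<noteq> 0" and t: "t \<in> I"
  shows "\<tau> (u t) = t"
proof -
  have "\<exists>c. \<forall>t\<in>I. \<tau> (u t) - t = c"
  proof (rule has_field_derivative_zero_constant)
    show "convex I" using assms(1) by (simp add: is_interval_convex)
    fix t assume t: "t \<in> I"
    have "((\<lambda>t. \<tau> (u t)) has_real_derivative 1 / v t * v t) (at t within I)"
      using DERIV_chain2[OF d\<tau>[OF t] du[OF t]] .
    then show "((\<lambda>t. \<tau> (u t) - t) has_real_derivative 0) (at t within I)"
      using assms(6)[OF t] by (auto intro!: derivative_eq_intros)
  qed
  then have "\<tau> (u t) - t = \<tau> (u 0) - 0" using assms(2) t by metis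
  then show ?thesis using assms(3) by simp
qed

section \<open>Collapse in finite time\<close>

text \<open>
  Since \<open>v0 \<noteq> 0\<close>, the energy equation determines the motion, so that continuity of \<open>F\<close> suffices for
  uniqueness. An attractor that is not singular at \<open>0\<close> is covered as well: the body then collides
  with finite speed.
\<close>

theorem collapse_under_attracting_force:
  fixes F :: "real \<Rightarrow> real"
  assumes U: "U \<in> {0<..<L}" and "v0 < 0"
    and F_cont: "continuous_on {0<..<L} F"
    and F_le: "\<And>x. x \<in> {0<..<L} \<Longrightarrow> F x \<le> 0"
    and max: "maximal_solution F {0<..<L} U v0 I u"
  shows "strict_antimono_on I u"
    and "\<exists>T>0. I = {0..<T} \<and> (\<forall>t\<in>{0..<T}. u t \<in> {0<..<L}) \<and>
           (u \<longlongrightarrow> 0) (at_left T) \<and> T \<le> U / \<bar>v0\<bar>"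
proof -
  have sol: "solves_on F {0<..<L} U v0 I u"
    using max unfolding maximal_solution_def by blast
  then have I: "is_interval I" "0 \<in> I" "I \<subseteq> {0..}" and u0: "u 0 = U"
    and u_in: "\<And>t. t \<in> I \<Longrightarrow> u t \<in> {0<..<L}"
    unfolding solves_on_def by blast+
  have "0 < L" "0 < v0\<^sup>2" using U \<open>v0 < 0\<close> by auto
  obtain Q where QU: "Q U = v0\<^sup>2"
    and dQ: "\<And>x. x \<in> {0<..<L} \<Longrightarrow> (Q has_real_derivative 2 * F x) (at x)"
    using antiderivative_on_open_interval[OF \<open>0 < L\<close>
        continuous_on_mult[OF continuous_on_const[of _ 2] F_cont], of U "v0\<^sup>2"] by blast
  have Q_ge: "v0\<^sup>2 \<le> Q x" if "0 < x" "x \<le> U" for x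
  proof -
    have "Q U \<le> Q x"
      by (rule DERIV_nonpos_imp_nonincreasing[OF that(2)])
        (use dQ F_le that U in \<open>force\<close>)
    then show ?thesis using QU by simp
  qed
  have Q_u: "v0\<^sup>2 \<le> Q (u t)"
    and du: "(u has_real_derivative - sqrt (Q (u t))) (at t within I)" if "t \<in> I" for t
    using velocity_from_energy[OF sol \<open>v0 < 0\<close> F_le dQ QU] that by blast+
  \<comment> \<open>To the right of \<open>U\<close>, where \<open>Q\<close> may become negative, the cut-off at \<open>v0\<^sup>2\<close> keeps the slowness
    positive and bounded; no solution ever goes there.\<close>
  define h where "h x = 1 / sqrt (max (Q x) (v0\<^sup>2))" for x
  have h_eq: "h x = 1 / sqrt (Q x)" if "v0\<^sup>2 \<le> Q x" for x
    using that by (simp add: h_def max_def)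
  have h_pos: "0 < h x" for x
    using \<open>0 < v0\<^sup>2\<close> by (simp add: h_def less_max_iff_disj)
  have h_le: "h x \<le> 1 / \<bar>v0\<bar>" for x
  proof -
    have "\<bar>v0\<bar> \<le> sqrt (max (Q x) (v0\<^sup>2))"
      by (rule real_le_rsqrt) simp
    then show ?thesis
      unfolding h_def using \<open>v0 < 0\<close>
      by (intro divide_left_mono mult_pos_pos) (auto simp: less_max_iff_disj)
  qed
  have "continuous_on {0<..<L} Q"
    using dQ DERIV_isCont by (blast intro: continuous_at_imp_continuous_on)
  moreover have "sqrt (max (Q x) (v0\<^sup>2)) \<noteq> 0" for x
    using h_pos[of x] by (auto simp: h_def)
  ultimately have "continuous_on {0<..<L} (\<lambda>x. - h x)"
    unfolding h_def by (intro continuous_intros) auto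
  then obtain \<tau> where \<tau>U: "\<tau> U = 0"
    and d\<tau>: "\<And>x. x \<in> {0<..<L} \<Longrightarrow> (\<tau> has_real_derivative - h x) (at x)"
    using antiderivative_on_open_interval[OF \<open>0 < L\<close>, of "\<lambda>x. - h x" U 0] by blast
  obtain w T where T: "0 < T" "T \<le> 1 / \<bar>v0\<bar> * U" and w0: "w 0 = U"
    and w_in: "\<And>t. t \<in> {0..<T} \<Longrightarrow> w t \<in> {0<..U}"
    and dw: "\<And>t. t \<in> {0..<T} \<Longrightarrow> (w has_real_derivative - 1 / h (w t)) (at t)"
    and w_\<tau>: "\<And>x. x \<in> {0<..<L} \<Longrightarrow> 0 \<le> \<tau> x \<Longrightarrow> \<tau> x < T \<and> w (\<tau> x) = x"
    and w_lim: "(w \<longlongrightarrow> 0) (at_left T)"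
    using fall_time_inverse[OF U \<tau>U d\<tau> h_pos h_le] by blast

  have w_sol: "solves_on F {0<..<L} U v0 {0..<T} w"
    unfolding solves_on_def
  proof (intro conjI ballI exI[of _ "\<lambda>t. - sqrt (Q (w t))"])
    show "is_interval {0..<T}" by (simp add: is_interval_1)
    show "{0..<T} \<noteq> {0}" using T(1) by (metis atLeastLessThan_iff dense less_imp_le
          less_irrefl singletonD)
    show "- sqrt (Q (w 0)) = v0" using w0 QU \<open>v0 < 0\<close> by simp
    fix t assume t: "t \<in> {0..<T}"
    have wt: "0 < w t" "w t \<le> U" using w_in[OF t] by auto
    then show wL: "w t \<in> {0<..<L}" using U by simp
    have Qw: "v0\<^sup>2 \<le> Q (w t)" using Q_ge wt by blast
    then have Q_pos: "0 < Q (w t)" using \<open>0 < v0\<^sup>2\<close> by linarith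
    have dwt: "(w has_real_derivative - sqrt (Q (w t))) (at t)"
      using dw[OF t] h_eq[OF Qw] by simp
    then show "(w has_real_derivative - sqrt (Q (w t))) (at t within {0..<T})"
      by (rule has_field_derivative_at_within)
    have "((\<lambda>t. Q (w t)) has_real_derivative 2 * F (w t) * - sqrt (Q (w t))) (at t)"
      using DERIV_chain2[OF dQ[OF wL] dwt] .
    then have "((\<lambda>t. - sqrt (Q (w t))) has_real_derivative
        - (inverse (sqrt (Q (w t))) / 2 * (2 * F (w t) * - sqrt (Q (w t))))) (at t)"
      by (intro DERIV_minus DERIV_chain2[of sqrt _ "\<lambda>t. Q (w t)"] DERIV_real_sqrt Q_pos)
    then have "((\<lambda>t. - sqrt (Q (w t))) has_real_derivative F (w t)) (at t)"
      using Q_pos by (simp add: field_simps)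
    then show "((\<lambda>t. - sqrt (Q (w t))) has_real_derivative F (w t)) (at t within {0..<T})"
      by (rule has_field_derivative_at_within)
  qed (use T w0 in auto)

  have \<tau>_u: "\<tau> (u t) = t" if "t \<in> I" for t
  proof (rule fall_time_along_solution[where \<tau> = \<tau> and u = u
        and v = "\<lambda>s. - sqrt (Q (u s))", OF I(1,2) _ _ _ _ that])
    show "\<tau> (u 0) = 0" using u0 \<tau>U by simp
    fix s assume s: "s \<in> I"
    show "(u has_real_derivative - sqrt (Q (u s))) (at s within I)" by (rule du[OF s])
    show "(\<tau> has_real_derivative 1 / - sqrt (Q (u s))) (at (u s))"
      using d\<tau>[OF u_in[OF s]] h_eq[OF Q_u[OF s]] by simp
    show "- sqrt (Q (u s)) \<noteq> 0" using less_le_trans[OF \<open>0 < v0\<^sup>2\<close> Q_u[OF s]] by simp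
  qed
  have u_w: "t < T \<and> w t = u t" if "t \<in> I" for t
    using w_\<tau>[OF u_in[OF that]] \<tau>_u[OF that] I(3) that by auto
  then have I_eq: "I = {0..<T}"
    using max w_sol I(3) unfolding maximal_solution_def by (metis atLeastLessThan_iff
        atLeast_iff subset_iff)
  have "(u \<longlongrightarrow> 0) (at_left T)"
  proof (rule Lim_transform_eventually[OF w_lim])
    show "\<forall>\<^sub>F t in at_left T. w t = u t"
      using eventually_at_left_real[OF T(1)] by eventually_elim (use u_w I_eq in auto)
  qed
  then show "\<exists>T>0. I = {0..<T} \<and> (\<forall>t\<in>{0..<T}. u t \<in> {0<..<L}) \<and>
           (u \<longlongrightarrow> 0) (at_left T) \<and> T \<le> U / \<bar>v0\<bar>"
    using T I_eq u_in by (intro exI[of _ T]) auto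
  show "strict_antimono_on I u"
  proof (rule monotone_onI)
    fix s t assume st: "s \<in> I" "t \<in> I" "s < t"
    obtain r where r: "r \<in> I" "u t - u s = - sqrt (Q (u r)) * (t - s)"
      using mvt_within_interval[OF I(1) st du] by blast
    have "0 < sqrt (Q (u r)) * (t - s)"
      using less_le_trans[OF \<open>0 < v0\<^sup>2\<close> Q_u[OF r(1)]] st(3) by simp
    then show "u t < u s" using r(2) by simp
  qed
qed

theorem mainTheorem1:
  fixes G M Mstar L U v0 a b :: real
    and I :: "real set" and u :: "real \<Rightarrow> real"
  assumes "G > 0" and "M > 0" and "Mstar \<ge> 0" and "L > 0"
    and "U \<in> {0<..<L}" and "v0 < 0"
    and "a = 2 * G * M" and "b = 2 * G * Mstar"
    and "maximal_solution (\<lambda>x. - (a / (2 * x\<^sup>2)) - b / (2 * (L - x)\<^sup>2)) {0<..<L} U v0 I u"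
  shows "strict_antimono_on I u \<and>
         (\<exists>T>0. I = {0..<T} \<and> (\<forall>t\<in>{0..<T}. u t \<in> {0<..<L}) \<and>
                (u \<longlongrightarrow> 0) (at_left T) \<and> T \<le> U / \<bar>v0\<bar>)"
proof -
  let ?F = "\<lambda>x. - (a / (2 * x\<^sup>2)) - b / (2 * (L - x)\<^sup>2)"
  have "0 \<le> a" "0 \<le> b" using assms by auto
  then have "0 \<le> a / (2 * x\<^sup>2)" "0 \<le> b / (2 * (L - x)\<^sup>2)" for x
    by (intro divide_nonneg_nonneg; simp)+
  then have "?F x \<le> 0" for x
    using diff_mono[of "- (a / (2 * x\<^sup>2))" 0 0] by force
  moreover have "continuous_on {0<..<L} ?F"
    by (intro continuous_intros) auto
  ultimately show ?thesis
    using collapse_under_attracting_force[OF assms(5,6) _ _ assms(9)] by blast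
qed

end
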